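(* Let $\Phi_h:(q^n,p^n)\mapsto(q^{n+1},p^{n+1})$ be the numerical flow of a one-stage explicit ERKN integrator satisfying the symmetry condition $$c_1=\tfrac12,\qquad (I+\cos(h\Omega))\,\bar b_1(h\Omega)=\mathrm{sinc}(h\Omega)\,b_1(h\Omega),$$ let $$\Upsilon(h\Omega)=b_1(h\Omega)\cos^{-1}(\tfrac12h\Omega)=2\bar b_1(h\Omega)\,\mathrm{sinc}^{-1}(\tfrac12h\Omega),$$ and let $\hat\Phi_h=\Phi_{h/2,\mathrm{NL}}\circ\Phi_{h,\mathrm L}\circ\Phi_{h/2,\mathrm{NL}}$ be the symmetric trigonometric integrator associated with this $\Upsilon$ (see context). Then $$\Phi_h=\Phi_{-h/2,\mathrm L}\circ\Phi_{-h/2,\mathrm{NL}}\circ\hat\Phi_h\circ\Phi_{h/2,\mathrm{NL}}\circ\Phi_{h/2,\mathrm L}.$$ Moreover, for every integer $n\ge1$, $$\begin{aligned}\underbrace{\Phi_h\circ\cdots\circ\Phi_h}_{n\text{ times}}&=\Phi_{-h/2,\mathrm L}\circ\Phi_{-h/2,\mathrm{NL}}\circ\big(\underbrace{\hat\Phi_h\circ\cdots\circ\hat\Phi_h}_{n\text{ times}}\big)\circ\Phi_{h/2,\mathrm{NL}}\circ\Phi_{h/2,\mathrm L}\\&=\Phi_{h/2,\mathrm L}\circ\Phi_{h/2,\mathrm{NL}}\circ\big(\underbrace{\hat\Phi_h\circ\cdots\circ\hat\Phi_h}_{n-1\text{ times}}\big)\circ\Phi_{h/2,\mathrm{NL}}\circ\Phi_{h/2,\mathrm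 L}.\end{aligned}$$
   Context: Setting. $\Omega=\begin{pmatrix}0&0\\0&\omega I\end{pmatrix}$ on $\mathbb R^{d_1}\times\mathbb R^{d_2}$ with $\omega>0$, $h>0$ is the stepsize, $g=-\nabla U$ for a real-valued smooth function $U$ on $\mathbb R^{d_1+d_2}$. $\mathrm{sinc}(x)=\sin(x)/x$, $\mathrm{sinc}(0)=1$; functions of $h\Omega$ act entrywise on the diagonal, and $\cos^{-1}(\cdot)$, $\mathrm{sinc}^{-1}(\cdot)$ denote the inverse matrices of $\cos(\cdot)$, $\mathrm{sinc}(\cdot)$ (assumed to exist). $\Omega^{-1}\sin(s\Omega)$ is understood as $s\,\mathrm{sinc}(s\Omega)$. ERKN integrator (with $c_1\in[0,1]$ and bounded real functions $\bar b_1,b_1$) for $q''+\Omega^2q=g(q)$: $$\begin{aligned}Q^{n+c_1}&=\cos(c_1h\Omega)q^n+c_1h\,\mathrm{sinc}(c_1h\Omega)p^n,\\ q^{n+1}&=\cos(h\Omega)q^n+h\,\mathrm{sinc}(h\Omega)p^n+h^2\bar b_1(h\Omega)g(Q^{n+c_1}),\\ p^{n+1}&=-h\Omega^2\mathrm{sinc}(h\Omega)q^n+\cos(h\Omega)p^n+h\,b_1(h\Omega)g(Q^{n+c_1}).\end{aligned}$$ Splitting flows. With $h$ and hence $\Upsilon(h\Omega)$ fixed, for real $s$: $\Phi_{s,\mathrm L}$ is the time-$s$ flow of the linear equation $\frac{d}{dt}(q,p)=(p,-\Omega^2q)$, i.e. $\Phi_{s,\mathrm L}(q,p)=(\cos(s\Omega)q+\Omega^{-1}\sin(s\Omega)p,\,-\Omega\sin(s\Omega)q+\cos(s\Omega)p)$;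 $\Phi_{s,\mathrm{NL}}$ is the time-$s$ flow of $\frac{d}{dt}(q,p)=(0,\Upsilon(h\Omega)g(q))$, i.e. $\Phi_{s,\mathrm{NL}}(q,p)=(q,\,p+s\Upsilon(h\Omega)g(q))$. The trigonometric integrator $\hat\Phi_h=\Phi_{h/2,\mathrm{NL}}\circ\Phi_{h,\mathrm L}\circ\Phi_{h/2,\mathrm{NL}}$ written out is $$\begin{aligned}q^{n+1}&=\cos(h\Omega)q^n+h\,\mathrm{sinc}(h\Omega)p^n+\tfrac12h^2\mathrm{sinc}(h\Omega)\Upsilon(h\Omega)g(q^n),\\ p^{n+1}&=-\Omega\sin(h\Omega)q^n+\cos(h\Omega)p^n+\tfrac12h\big(\cos(h\Omega)\Upsilon(h\Omega)g(q^n)+\Upsilon(h\Omega)g(q^{n+1})\big).\end{aligned}$$ *)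

theory Defs
  imports "HOL-Analysis.Analysis" "HOL-Probability.Sinc_Integral"
begin

text \<open>\<open>C\<^sup>k\<close> and \<open>C\<^sup>\<infinity>\<close> on the whole space, by iterated partial derivatives.\<close>

primrec k_times_cont_diff :: "nat \<Rightarrow> ('a::euclidean_space \<Rightarrow> real) \<Rightarrow> bool" where
  "k_times_cont_diff 0 f \<longleftrightarrow> continuous_on UNIV f"
| "k_times_cont_diff (Suc k) f \<longleftrightarrow>
     (\<forall>x. f differentiable (at x)) \<and>
     (\<forall>b\<in>Basis. k_times_cont_diff k (\<lambda>x. frechet_derivative f (at x) b))"

definition smooth :: "('a::euclidean_space \<Rightarrow> real) \<Rightarrow> bool" where
  "smooth f \<longleftrightarrow> (\<forall>k. k_times_cont_diff k f)"

text \<open>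
  \<open>\<real>\<^sup>d\<^sup>1 \<times> \<real>\<^sup>d\<^sup>2\<close> is rendered as the space of vectors indexed by the disjoint
  sum \<^typ>\<open>'d1 + 'd2\<close>, so that the block matrix \<open>\<Omega>\<close> is an ordinary square matrix.
\<close>

definition Omega :: "real \<Rightarrow> real ^ ('d1::finite + 'd2::finite) ^ ('d1 + 'd2)" where
  "Omega \<omega> = (\<chi> i j. case (i, j) of
      (Inr k, Inr l) \<Rightarrow> (mat \<omega> :: real ^ 'd2 ^ 'd2) $ k $ l
    | _ \<Rightarrow> 0)"

text \<open>
  Only meant for diagonal \<open>A\<close>, where it is the usual matrix function \<open>f(A)\<close>.
\<close>

definition dfun :: "(real \<Rightarrow> real) \<Rightarrow> real ^ 'n ^ 'n \<Rightarrow> real ^ 'n ^ 'n" where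
  "dfun f A = (\<chi> i j. if i = j then f (A $ i $ i) else 0)"

definition erkn_step ::
  "real \<Rightarrow> (real \<Rightarrow> real) \<Rightarrow> (real \<Rightarrow> real) \<Rightarrow> real \<Rightarrow> real ^ 'n ^ 'n \<Rightarrow> (real ^ 'n \<Rightarrow> real ^ 'n)
    \<Rightarrow> (real ^ 'n) \<times> (real ^ 'n) \<Rightarrow> (real ^ 'n) \<times> (real ^ 'n)" where
  "erkn_step c bbar b h Om g = (\<lambda>(q, p).
     let Q = dfun cos ((c * h) *\<^sub>R Om) *v q + (c * h) *\<^sub>R (dfun sinc ((c * h) *\<^sub>R Om) *v p)
     in (dfun cos (h *\<^sub>R Om) *v q + h *\<^sub>R (dfun sinc (h *\<^sub>R Om) *v p)
           + h\<^sup>2 *\<^sub>R (dfun bbar (h *\<^sub>R Om) *v g Q),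
         - h *\<^sub>R ((Om ** Om ** dfun sinc (h *\<^sub>R Om)) *v q) + dfun cos (h *\<^sub>R Om) *v p
           + h *\<^sub>R (dfun b (h *\<^sub>R Om) *v g Q)))"

text \<open>
  The two split flows, by their solution formulas; \<open>\<Omega>\<^sup>-\<^sup>1 sin(s\<Omega>)\<close> is read as
  \<open>s sinc(s\<Omega>)\<close>. The lemmas below confirm that they solve the split equations.
  The matrix \<open>Ups\<close> stands for \<open>\<Upsilon>(h\<Omega>)\<close> and does not vary with the time \<open>s\<close>.
\<close>

definition flow_L ::
  "real ^ 'n ^ 'n \<Rightarrow> real \<Rightarrow> (real ^ 'n) \<times> (real ^ 'n) \<Rightarrow> (real ^ 'n) \<times> (real ^ 'n)" where
  "flow_L Om s = (\<lambda>(q, p).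
     (dfun cos (s *\<^sub>R Om) *v q + s *\<^sub>R (dfun sinc (s *\<^sub>R Om) *v p),
      - ((Om ** dfun sin (s *\<^sub>R Om)) *v q) + dfun cos (s *\<^sub>R Om) *v p))"

definition flow_NL ::
  "real ^ 'n ^ 'n \<Rightarrow> (real ^ 'n \<Rightarrow> real ^ 'n) \<Rightarrow> real
    \<Rightarrow> (real ^ 'n) \<times> (real ^ 'n) \<Rightarrow> (real ^ 'n) \<times> (real ^ 'n)" where
  "flow_NL Ups g s = (\<lambda>(q, p). (q, p + s *\<^sub>R (Ups *v g q)))"

definition trig_step ::
  "real ^ 'n ^ 'n \<Rightarrow> real ^ 'n ^ 'n \<Rightarrow> (real ^ 'n \<Rightarrow> real ^ 'n) \<Rightarrow> real
    \<Rightarrow> (real ^ 'n) \<times> (real ^ 'n) \<Rightarrow> (real ^ 'n) \<times> (real ^ 'n)" where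
  "trig_step Om Ups g h = flow_NL Ups g (h / 2) \<circ> flow_L Om h \<circ> flow_NL Ups g (h / 2)"

lemma dfun_mult_vec: "dfun f A *v x = (\<chi> i. f (A $ i $ i) * x $ i)"
  by (simp add: dfun_def matrix_vector_mult_def vec_eq_iff if_distrib[of "\<lambda>u. u * _"] cong: if_cong)

lemma Omega_diagonal: "Omega \<omega> = dfun (\<lambda>x. x) (Omega \<omega>)"
  by (auto simp: Omega_def dfun_def vec_eq_iff mat_def split: sum.splits)

lemma flow_L_0: "flow_L Om 0 z = z"
proof (cases z)
  case (Pair q p)
  have "dfun sin (0 *\<^sub>R Om) *v q = 0" "dfun cos (0 *\<^sub>R Om) *v x = x" for x
    by (simp_all add: dfun_mult_vec vec_eq_iff)
  then show ?thesis
    by (simp add: Pair flow_L_def flip: matrix_vector_mul_assoc)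
qed

lemma flow_NL_0: "flow_NL Ups g 0 z = z"
  by (cases z) (simp add: flow_NL_def)

lemma has_vector_derivative_vec:
  fixes f :: "real \<Rightarrow> real ^ 'n"
  assumes "\<And>i. ((\<lambda>t. f t $ i) has_real_derivative f' $ i) (at s)"
  shows "(f has_vector_derivative f') (at s)"
proof -
  have "(\<lambda>x. x * c) = (*) c" for c :: real
    by (simp add: fun_eq_iff mult.commute)
  then show ?thesis
    using assms
    by (auto simp: has_vector_derivative_def has_derivative_componentwise_within[of f]
        Basis_vec_def inner_axis has_field_derivative_def)
qed

lemma flow_NL_solves:
  "((\<lambda>t. flow_NL Ups g t z) has_vector_derivative
     (0, Ups *v g (fst (flow_NL Ups g s z)))) (at s)"
  unfolding flow_NL_def
  by (cases z) (auto intro!: derivative_eq_intros)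

lemma flow_L_solves:
  fixes z :: "(real ^ ('d1::finite + 'd2::finite)) \<times> (real ^ ('d1 + 'd2))" and \<omega> :: real
  defines "Om \<equiv> Omega \<omega>"
  shows "((\<lambda>t. flow_L Om t z) has_vector_derivative
     (snd (flow_L Om s z), - ((Om ** Om) *v fst (flow_L Om s z)))) (at s)"
proof -
  obtain q p where z: "z = (q, p)" by (cases z)
  define a where "a = (\<lambda>i. Om $ i $ i)"
  have Omv: "Om *v x = (\<chi> i. a i * x $ i)" for x
    unfolding a_def Om_def by (subst Omega_diagonal) (rule dfun_mult_vec)
  have qc: "(dfun cos (t *\<^sub>R Om) *v q + t *\<^sub>R (dfun sinc (t *\<^sub>R Om) *v p)) $ i
      = cos (t * a i) * q $ i + (if a i = 0 then t * p $ i else sin (t * a i) / a i * p $ i)" for t i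
    by (auto simp: dfun_mult_vec a_def)
  have pc: "(- ((Om ** dfun sin (t *\<^sub>R Om)) *v q) + dfun cos (t *\<^sub>R Om) *v p) $ i
      = - (a i * (sin (t * a i) * q $ i)) + cos (t * a i) * p $ i" for t i
    by (simp add: dfun_mult_vec Omv a_def flip: matrix_vector_mul_assoc)
  have aac: "((Om ** Om) *v x) $ i = a i * (a i * x $ i)" for x i
    by (simp add: Omv flip: matrix_vector_mul_assoc)
  have 1: "((\<lambda>t. dfun cos (t *\<^sub>R Om) *v q + t *\<^sub>R (dfun sinc (t *\<^sub>R Om) *v p))
      has_vector_derivative snd (flow_L Om s z)) (at s)"
  proof (rule has_vector_derivative_vec)
    fix i
    show "((\<lambda>t. (dfun cos (t *\<^sub>R Om) *v q + t *\<^sub>R (dfun sinc (t *\<^sub>R Om) *v p)) $ i)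
        has_real_derivative snd (flow_L Om s z) $ i) (at s)"
      unfolding qc z flow_L_def prod.case snd_conv pc
      by (cases "a i = 0") (auto intro!: derivative_eq_intros)
  qed
  have 2: "((\<lambda>t. - ((Om ** dfun sin (t *\<^sub>R Om)) *v q) + dfun cos (t *\<^sub>R Om) *v p)
      has_vector_derivative - ((Om ** Om) *v fst (flow_L Om s z))) (at s)"
  proof (rule has_vector_derivative_vec)
    fix i
    show "((\<lambda>t. (- ((Om ** dfun sin (t *\<^sub>R Om)) *v q) + dfun cos (t *\<^sub>R Om) *v p) $ i)
        has_real_derivative (- ((Om ** Om) *v fst (flow_L Om s z))) $ i) (at s)"
      unfolding z flow_L_def prod.case fst_conv pc vector_uminus_component aac qc
      by (cases "a i = 0") (auto simp: algebra_simps intro!: derivative_eq_intros)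
  qed
  show ?thesis
    using has_vector_derivative_Pair[OF 1 2] by (simp add: z flow_L_def)
qed

text \<open>The trigonometric integrator written out in the usual one-step form.\<close>

lemma trig_step_expand:
  "trig_step Om Ups g h (q, p) =
    (let q' = dfun cos (h *\<^sub>R Om) *v q + h *\<^sub>R (dfun sinc (h *\<^sub>R Om) *v p)
          + (h\<^sup>2 / 2) *\<^sub>R ((dfun sinc (h *\<^sub>R Om) ** Ups) *v g q)
     in (q', - ((Om ** dfun sin (h *\<^sub>R Om)) *v q) + dfun cos (h *\<^sub>R Om) *v p
          + (h / 2) *\<^sub>R ((dfun cos (h *\<^sub>R Om) ** Ups) *v g q + Ups *v g q')))"
proof -
  have A: "A *v (p + (h / 2) *\<^sub>R (Ups *v g q)) = A *v p + (h / 2) *\<^sub>R ((A ** Ups) *v g q)"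
    for A :: "real ^ 'a ^ 'a"
    by (simp add: matrix_vector_right_distrib matrix_vector_mult_scaleR matrix_vector_mul_assoc)
  show ?thesis
    by (simp only: trig_step_def o_apply flow_NL_def flow_L_def prod.case A Let_def prod.inject)
      (simp add: scaleR_add_right power2_eq_square add.assoc)
qed

end

theory Submission
  imports Defs
begin

text \<open>
  \<open>\<Phi>\<^sub>h\<close> is the Strang splitting with the roles of the two flows
  exchanged: \<open>\<Phi>\<^sub>h = \<Phi>\<^bsub>h/2,L\<^esub> \<circ> \<Phi>\<^bsub>h,NL\<^esub> \<circ> \<Phi>\<^bsub>h/2,L\<^esub>\<close>. Both conjugation formulas then follow from the
  group laws of the flows. Since all matrices are diagonal, the integrators are compared entrywise,
  and half-angle formulas reduce the symmetry condition to \<open>2 cos(x/2) b\<^sub>1-bar(x) = sinc(x/2) b\<^sub>1(x)\<close>.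
\<close>

lemma dfun_mult: "dfun f A ** dfun g B = (\<chi> i j. if i = j then f (A $ i $ i) * g (B $ i $ i) else 0)"
  by (simp add: dfun_def matrix_matrix_mult_def vec_eq_iff if_distrib[of "\<lambda>u. u * _"] cong: if_cong)

text \<open>A zero entry \<open>f (A $ i $ i)\<close> would kill the \<open>i\<close>-th component
  of \<open>dfun f A *v y\<close> for every \<open>y\<close>, yet a right inverse maps
  \<open>axis i 1\<close> to a \<open>y\<close> for which that component is 1.\<close>

lemma dfun_invertible_nonzero:
  assumes "invertible (dfun f A)"
  shows "f (A $ i $ i) \<noteq> 0"
proof
  assume 0: "f (A $ i $ i) = 0"
  obtain B where "dfun f A ** B = mat 1"
    using assms by (auto simp: invertible_def)
  then have "(dfun f A *v (B *v axis i 1)) $ i = (1 :: real)"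
    by (simp add: matrix_vector_mul_assoc)
  then show False
    by (simp add: dfun_mult_vec 0)
qed

lemma matrix_inv_dfun:
  assumes "invertible (dfun f A)"
  shows "matrix_inv (dfun f A) = dfun (\<lambda>x. inverse (f x)) A"
proof -
  let ?B = "dfun (\<lambda>x. inverse (f x)) A"
  have B: "dfun f A ** ?B = mat 1" "?B ** dfun f A = mat 1"
    using dfun_invertible_nonzero[OF assms] by (simp_all add: dfun_mult mat_def vec_eq_iff)
  then have "matrix_inv (dfun f A) ** dfun f A = mat 1"
    unfolding matrix_inv_def by (metis (mono_tags, lifting) someI_ex)
  then show ?thesis
    by (metis B(1) matrix_mul_assoc matrix_mul_lid matrix_mul_rid)
qed

text \<open>The hypothesis is the form in which diagonality is carried from here on;
  \<open>Omega_diagonal\<close> supplies it for \<open>Omega\<close>.\<close>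

lemma diagonal_mult_vec:
  assumes "A = dfun (\<lambda>x. x) A"
  shows "A *v x = (\<chi> i. A $ i $ i * x $ i)"
  by (subst assms) (rule dfun_mult_vec)

text \<open>Replaces the case split on \<open>t * a = 0\<close> hidden in \<open>sinc\<close> by one
  on \<open>a = 0\<close>, so that different times share the same cases.\<close>

lemma mult_sinc: "t * sinc (t * a) = (if a = 0 then t else sin (t * a) / a)"
  by auto

lemma sinc_double: "sinc (x::real) = sinc (x / 2) * cos (x / 2)"
  using sin_double[of "x / 2"] by auto

lemma flow_L_components:
  assumes "Om = dfun (\<lambda>x. x) Om"
  shows "fst (flow_L Om t z) $ i =
      cos (t * Om $ i $ i) * fst z $ i + t * sinc (t * Om $ i $ i) * snd z $ i"
    and "snd (flow_L Om t z) $ i =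
      cos (t * Om $ i $ i) * snd z $ i - Om $ i $ i * sin (t * Om $ i $ i) * fst z $ i"
  by (simp_all add: flow_L_def case_prod_beta dfun_mult_vec diagonal_mult_vec[OF assms]
      flip: matrix_vector_mul_assoc)

text \<open>Entrywise, these are the addition formulas of sine and cosine; entries with frequency 0
  undergo free motion, where times add up trivially.\<close>

lemma flow_L_add:
  assumes "Om = dfun (\<lambda>x. x) Om"
  shows "flow_L Om s (flow_L Om t z) = flow_L Om (s + t) z"
proof -
  have "fst (flow_L Om s (flow_L Om t z)) $ i = fst (flow_L Om (s + t) z) $ i"
    "snd (flow_L Om s (flow_L Om t z)) $ i = snd (flow_L Om (s + t) z) $ i" for i
    unfolding flow_L_components[OF assms] mult_sinc
    by (auto simp: distrib_right cos_add sin_add field_simps)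
  then show ?thesis
    by (simp add: prod_eq_iff vec_eq_iff)
qed

lemma flow_NL_add: "flow_NL Ups g s (flow_NL Ups g t z) = flow_NL Ups g (s + t) z"
  by (simp add: flow_NL_def case_prod_beta algebra_simps)

lemma flow_L_minus_cancel:
  assumes "Om = dfun (\<lambda>x. x) Om"
  shows "flow_L Om s (flow_L Om (- s) z) = z" and "flow_L Om (- s) (flow_L Om s z) = z"
  by (simp_all add: flow_L_add[OF assms] flow_L_0)

lemma flow_NL_minus_cancel:
  "flow_NL Ups g s (flow_NL Ups g (- s) z) = z" "flow_NL Ups g (- s) (flow_NL Ups g s z) = z"
  by (simp_all add: flow_NL_add flow_NL_0)

text \<open>Starting at a point \<open>v x\<close>, each application of \<open>u\<close> meets a
  preceding \<open>v\<close> and cancels it.\<close>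

lemma funpow_conjugate:
  assumes "\<And>x. u (v x) = x"
  shows "((v \<circ> f \<circ> u) ^^ n) (v x) = v ((f ^^ n) x)"
  by (induction n) (simp_all add: assms)

text \<open>Exhibits the integrator as the exact linear flow plus multiples of one force value,
  taken at the position that the linear flow reaches at time \<open>c * h\<close>.\<close>

lemma erkn_step_components:
  fixes z :: "(real ^ 'n) \<times> (real ^ 'n)" and g :: "real ^ 'n \<Rightarrow> real ^ 'n" and c h :: real
  assumes "Om = dfun (\<lambda>x. x) Om"
  defines "G \<equiv> g (fst (flow_L Om (c * h) z))"
  shows "fst (erkn_step c bbar b h Om g z) $ i =
      fst (flow_L Om h z) $ i + h\<^sup>2 * bbar (h * Om $ i $ i) * G $ i"
    and "snd (erkn_step c bbar b h Om g z) $ i =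
      snd (flow_L Om h z) $ i + h * b (h * Om $ i $ i) * G $ i"
proof -
  have G: "g (dfun cos ((c * h) *\<^sub>R Om) *v fst z
      + (c * h) *\<^sub>R (dfun sinc ((c * h) *\<^sub>R Om) *v snd z)) = G"
    by (simp add: G_def flow_L_def case_prod_beta)
  show "fst (erkn_step c bbar b h Om g z) $ i =
      fst (flow_L Om h z) $ i + h\<^sup>2 * bbar (h * Om $ i $ i) * G $ i"
    by (simp add: erkn_step_def case_prod_beta Let_def G flow_L_def) (simp add: dfun_mult_vec)
  have "h * (a * (a * (sinc (h * a) * y))) = a * (sin (h * a) * y)" for a y :: real
    by auto
  then show "snd (erkn_step c bbar b h Om g z) $ i =
      snd (flow_L Om h z) $ i + h * b (h * Om $ i $ i) * G $ i"
    by (simp add: erkn_step_def case_prod_beta Let_def G flow_L_def)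
      (simp add: dfun_mult_vec diagonal_mult_vec[OF assms(1)] flip: matrix_vector_mul_assoc)
qed

text \<open>The kick adds \<open>h * u * G\<close> to the momentum at half time. The remaining half
  linear flow turns it into \<open>h * (h / 2) * sinc * u * G\<close> in position and
  \<open>h * cos * u * G\<close> in momentum, which the hypotheses identify with the ERKN
  weights.\<close>

lemma erkn_step_eq_splitting:
  assumes diag: "Om = dfun (\<lambda>x. x) Om"
    and Ups: "Ups = dfun u (h *\<^sub>R Om)"
    and b: "\<And>i. b (h * Om $ i $ i) = cos (h / 2 * Om $ i $ i) * u (h * Om $ i $ i)"
    and bbar: "\<And>i. 2 * bbar (h * Om $ i $ i) = sinc (h / 2 * Om $ i $ i) * u (h * Om $ i $ i)"
  shows "erkn_step (1 / 2) bbar b h Om g z = flow_L Om (h / 2) (flow_NL Ups g h (flow_L Om (h / 2) z))"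
proof -
  define w where "w = flow_L Om (h / 2) z"
  \<comment> \<open>Both sides become expressions in the midpoint state \<open>w\<close>, whose
    position is the internal stage for \<open>c = 1 / 2\<close>.\<close>
  have h: "flow_L Om h z = flow_L Om (h / 2) w"
    by (simp add: w_def flow_L_add[OF diag])
  have NL: "fst (flow_NL Ups g h w) = fst w"
    "snd (flow_NL Ups g h w) $ i = snd w $ i + h * (u (h * Om $ i $ i) * g (fst w) $ i)" for i
    by (simp_all add: flow_NL_def case_prod_beta Ups dfun_mult_vec)
  have bbar': "bbar (h * Om $ i $ i) = sinc (h / 2 * Om $ i $ i) * u (h * Om $ i $ i) / 2" for i
    using bbar[of i] by simp
  have "fst (erkn_step (1 / 2) bbar b h Om g z) $ i = fst (flow_L Om (h / 2) (flow_NL Ups g h w)) $ i"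
    "snd (erkn_step (1 / 2) bbar b h Om g z) $ i = snd (flow_L Om (h / 2) (flow_NL Ups g h w)) $ i" for i
    unfolding erkn_step_components[OF diag] h flow_L_components[OF diag] NL b bbar'
    by (simp_all add: w_def algebra_simps power2_eq_square)
  then show ?thesis
    by (simp add: prod_eq_iff vec_eq_iff w_def)
qed

text \<open>On the right the first half kick of \<open>trig_step\<close> merges with the one before
  it into a full kick, its last one cancels, and the linear times add to
  \<open>h / 2\<close>.\<close>

lemma splitting_eq_conjugate:
  assumes "Om = dfun (\<lambda>x. x) Om"
  shows "flow_L Om (h / 2) \<circ> flow_NL Ups g h \<circ> flow_L Om (h / 2)
    = flow_L Om (- h / 2) \<circ> flow_NL Ups g (- h / 2) \<circ> trig_step Om Ups g h
        \<circ> flow_NL Ups g (h / 2) \<circ> flow_L Om (h / 2)"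
  by (simp add: fun_eq_iff trig_step_def flow_NL_add flow_L_add[OF assms] flow_NL_0)

lemma funpow_conjugate_flows:
  fixes Ups Om :: "real ^ 'n ^ 'n" and g :: "real ^ 'n \<Rightarrow> real ^ 'n" and h :: real
  assumes diag: "Om = dfun (\<lambda>x. x) Om"
  defines "u \<equiv> flow_NL Ups g (h / 2) \<circ> flow_L Om (h / 2)"
    and "v \<equiv> flow_L Om (- h / 2) \<circ> flow_NL Ups g (- h / 2)"
  shows "(v \<circ> f \<circ> u) ^^ n = v \<circ> (f ^^ n) \<circ> u"
proof
  fix x
  have uv: "u (v y) = y" and vu: "v (u y) = y" for y
    by (simp_all add: u_def v_def flow_L_minus_cancel[OF diag] flow_NL_minus_cancel)
  show "((v \<circ> f \<circ> u) ^^ n) x = (v \<circ> (f ^^ n) \<circ> u) x"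
    \<comment> \<open>Every \<open>x\<close> has the form \<open>v (u x)\<close>, so the
      cancellation at points \<open>v y\<close> covers all of them.\<close>
    using funpow_conjugate[of u v n f "u x"] by (simp add: uv vu)
qed

lemma conjugated_trig_step:
  assumes "Om = dfun (\<lambda>x. x) Om"
  shows "flow_L Om (- h / 2) \<circ> flow_NL Ups g (- h / 2) \<circ> trig_step Om Ups g h
    = flow_L Om (h / 2) \<circ> flow_NL Ups g (h / 2)"
  by (simp add: fun_eq_iff trig_step_def flow_NL_add flow_L_add[OF assms] flow_NL_0)

theorem proposition4p1:
  fixes U :: "real ^ ('d1::finite + 'd2::finite) \<Rightarrow> real"
    and g :: "real ^ ('d1 + 'd2) \<Rightarrow> real ^ ('d1 + 'd2)"
    and \<omega> h c\<^sub>1 :: real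
    and b\<^sub>1 bbar\<^sub>1 :: "real \<Rightarrow> real"
    and Ups :: "real ^ ('d1 + 'd2) ^ ('d1 + 'd2)"
  assumes "\<omega> > 0" and "h > 0"
    and "smooth U"
    and "\<And>q. GDERIV U q :> - g q"
    and "0 \<le> c\<^sub>1" and "c\<^sub>1 \<le> 1"
    and "bounded (range b\<^sub>1)" and "bounded (range bbar\<^sub>1)"
    and "c\<^sub>1 = 1 / 2"
    and "(mat 1 + dfun cos (h *\<^sub>R Omega \<omega>)) ** dfun bbar\<^sub>1 (h *\<^sub>R Omega \<omega>)
           = dfun sinc (h *\<^sub>R Omega \<omega>) ** (dfun b\<^sub>1 (h *\<^sub>R Omega \<omega>) :: real ^ ('d1 + 'd2) ^ ('d1 + 'd2))"
    and "invertible (dfun cos ((h / 2) *\<^sub>R Omega \<omega>) :: real ^ ('d1 + 'd2) ^ ('d1 + 'd2))"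
    and "invertible (dfun sinc ((h / 2) *\<^sub>R Omega \<omega>) :: real ^ ('d1 + 'd2) ^ ('d1 + 'd2))"
    and "Ups = dfun b\<^sub>1 (h *\<^sub>R Omega \<omega>) ** matrix_inv (dfun cos ((h / 2) *\<^sub>R Omega \<omega>))"
  shows "Ups = 2 *\<^sub>R (dfun bbar\<^sub>1 (h *\<^sub>R Omega \<omega>) ** matrix_inv (dfun sinc ((h / 2) *\<^sub>R Omega \<omega>)))
    \<and> erkn_step c\<^sub>1 bbar\<^sub>1 b\<^sub>1 h (Omega \<omega>) g
        = flow_L (Omega \<omega>) (- h / 2) \<circ> flow_NL Ups g (- h / 2) \<circ> trig_step (Omega \<omega>) Ups g h
            \<circ> flow_NL Ups g (h / 2) \<circ> flow_L (Omega \<omega>) (h / 2)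
    \<and> (\<forall>n\<ge>1.
        erkn_step c\<^sub>1 bbar\<^sub>1 b\<^sub>1 h (Omega \<omega>) g ^^ n
          = flow_L (Omega \<omega>) (- h / 2) \<circ> flow_NL Ups g (- h / 2) \<circ> (trig_step (Omega \<omega>) Ups g h ^^ n)
              \<circ> flow_NL Ups g (h / 2) \<circ> flow_L (Omega \<omega>) (h / 2)
        \<and> erkn_step c\<^sub>1 bbar\<^sub>1 b\<^sub>1 h (Omega \<omega>) g ^^ n
          = flow_L (Omega \<omega>) (h / 2) \<circ> flow_NL Ups g (h / 2) \<circ> (trig_step (Omega \<omega>) Ups g h ^^ (n - 1))
              \<circ> flow_NL Ups g (h / 2) \<circ> flow_L (Omega \<omega>) (h / 2))"
proof -
  let ?Om = "Omega \<omega> :: real ^ ('d1 + 'd2) ^ ('d1 + 'd2)"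
  let ?N = "flow_NL Ups g" and ?L = "flow_L ?Om" and ?T = "trig_step ?Om Ups g h"
  define a where "a = (\<lambda>i. ?Om $ i $ i)"
  have diag: "?Om = dfun (\<lambda>x. x) ?Om"
    by (rule Omega_diagonal)
  have cos0: "cos (h / 2 * a i) \<noteq> 0" and sinc0: "sinc (h / 2 * a i) \<noteq> 0" for i
    using dfun_invertible_nonzero[OF assms(11), of i] dfun_invertible_nonzero[OF assms(12), of i]
    unfolding vector_scaleR_component real_scaleR_def a_def .
  have sym: "2 * cos (h / 2 * a i) * bbar\<^sub>1 (h * a i) = sinc (h / 2 * a i) * b\<^sub>1 (h * a i)" for i
  proof -
    have "(1 + cos (h * a i)) * bbar\<^sub>1 (h * a i) = sinc (h * a i) * b\<^sub>1 (h * a i)"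
    proof -
      have "mat 1 + dfun cos (h *\<^sub>R ?Om) = dfun (\<lambda>x. 1 + cos x) (h *\<^sub>R ?Om)"
        by (simp add: dfun_def mat_def vec_eq_iff)
      from assms(10)[unfolded this dfun_mult, THEN arg_cong[where f = "\<lambda>M. M $ i $ i"]]
      show ?thesis
        by (simp add: a_def)
    qed
    moreover have "1 + cos (h * a i) = 2 * cos (h / 2 * a i) * cos (h / 2 * a i)"
      using cos_double_cos[of "h / 2 * a i"] by (simp add: power2_eq_square)
    moreover have "sinc (h * a i) = sinc (h / 2 * a i) * cos (h / 2 * a i)"
      using sinc_double[of "h * a i"] by simp
    \<comment> \<open>The half-angle formulas give both sides of the symmetry condition a common
      factor, which is nonzero by invertibility of cos(h\<Omega>/2).\<close>
    ultimately have "cos (h / 2 * a i) * (2 * cos (h / 2 * a i) * bbar\<^sub>1 (h * a i))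
        = cos (h / 2 * a i) * (sinc (h / 2 * a i) * b\<^sub>1 (h * a i))"
      by (simp only: ac_simps)
    then show ?thesis
      using cos0[of i] by simp
  qed
  \<comment> \<open>The scalar function behind \<Upsilon>, with argument \<open>x = h * a i\<close>;
    hence the \<open>x / 2\<close> under the cosine.\<close>
  define u where "u = (\<lambda>x. b\<^sub>1 x * inverse (cos (x / 2)))"
  have Ups: "Ups = dfun u (h *\<^sub>R ?Om)"
    unfolding assms(13) matrix_inv_dfun[OF assms(11)] dfun_mult
    by (simp add: u_def dfun_def vec_eq_iff)
  have b: "b\<^sub>1 (h * a i) = cos (h / 2 * a i) * u (h * a i)"
    and bbar: "2 * bbar\<^sub>1 (h * a i) = sinc (h / 2 * a i) * u (h * a i)" for i
    using cos0[of i] sym[of i] by (simp_all add: u_def field_simps)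
  \<comment> \<open>Solves the relation \<open>bbar\<close> for \<open>u\<close>, which yields the
    second formula for \<Upsilon> entrywise.\<close>
  have "v = 2 * (x * inverse s)" if "2 * x = s * v" "s \<noteq> 0" for v x s :: real
    using that by (simp add: field_simps)
  note Ups_entry = this[OF bbar sinc0]
  have "Ups = 2 *\<^sub>R (dfun bbar\<^sub>1 (h *\<^sub>R ?Om) ** matrix_inv (dfun sinc ((h / 2) *\<^sub>R ?Om)))"
    unfolding matrix_inv_dfun[OF assms(12)] dfun_mult Ups
    using Ups_entry[unfolded a_def] \<open>h > 0\<close> by (simp add: dfun_def vec_eq_iff)
  moreover have step: "erkn_step c\<^sub>1 bbar\<^sub>1 b\<^sub>1 h ?Om g
      = ?L (- h / 2) \<circ> ?N (- h / 2) \<circ> ?T \<circ> ?N (h / 2) \<circ> ?L (h / 2)"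
    unfolding splitting_eq_conjugate[OF diag, symmetric] assms(9)
    using erkn_step_eq_splitting[OF diag Ups b[unfolded a_def] bbar[unfolded a_def]]
    by (simp add: fun_eq_iff)
  moreover have pow: "erkn_step c\<^sub>1 bbar\<^sub>1 b\<^sub>1 h ?Om g ^^ n
      = ?L (- h / 2) \<circ> ?N (- h / 2) \<circ> (?T ^^ n) \<circ> ?N (h / 2) \<circ> ?L (h / 2)" for n
    using funpow_conjugate_flows[OF diag, where Ups = Ups and g = g and h = h and f = ?T] by (simp only: step comp_assoc)
  moreover have "erkn_step c\<^sub>1 bbar\<^sub>1 b\<^sub>1 h ?Om g ^^ n
      = ?L (h / 2) \<circ> ?N (h / 2) \<circ> (?T ^^ (n - 1)) \<circ> ?N (h / 2) \<circ> ?L (h / 2)" if "n \<ge> 1" for n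
  proof -
    \<comment> \<open>The leftmost \<open>?T\<close> is split off so that the outer backward flows
      absorb it and become forward half steps.\<close>
    have "?T ^^ n = ?T \<circ> ?T ^^ (n - 1)"
      using that by (cases n) simp_all
    then show ?thesis
      by (simp only: pow o_assoc conjugated_trig_step[OF diag])
  qed
  ultimately show ?thesis
    by blast
qed

end
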